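(* Let $G$ be a connected graph of order $n$ with diameter $d$, where $2\le d\le n-4$. (i) If $d\in\{2,3,4\}$, then $m_G[n-d,n]\le n-d+1$. (ii) If $d\ge 5$, then $m_G[n-d,n]\le n-d+2$.
   Context: All graphs are finite, simple and undirected; the order of a graph is its number of vertices. For a graph $G$ of order $n$, the Laplacian matrix is $L(G)=D(G)-A(G)$, where $A(G)$ is the adjacency matrix and $D(G)$ is the diagonal matrix of vertex degrees; its $n$ real eigenvalues (counted with multiplicity) are the Laplacian eigenvalues of $G$, and all of them lie in $[0,n]$. For an interval $I\subseteq[0,n]$, $m_GI$ denotes the number of Laplacian eigenvalues of $G$ lying in $I$, counted with multiplicities; thus $m_G[a,n]$ is the number of Laplacian eigenvalues of $G$ in the closed interval $[a,n]$. The diameter of a connected graph is the maximum distance over all pairs of its vertices. *)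

theory Defs
  imports
    "Graph_Theory.Graph_Theory"
    "Jordan_Normal_Form.Char_Poly"
begin

text \<open>
  Simple undirected graphs are the locale \<open>graph\<close> of \<open>Graph_Theory\<close>: finite, loop-free
  digraphs without parallel arcs whose arc relation is symmetric. An undirected edge is thus a
  pair of opposite arcs, and the degree of a vertex is its out-degree.

  Matrix rows and columns are numbered by a list \<open>vs\<close> that is meant to enumerate the
  vertices without repetition.
\<close>

definition adjacency_mat :: "('a, 'b) pre_digraph \<Rightarrow> 'a list \<Rightarrow> real mat" where
  "adjacency_mat G vs = mat (length vs) (length vs)
     (\<lambda>(i, j). if (vs ! i, vs ! j) \<in> arcs_ends G then 1 else 0)"

definition degree_mat :: "('a, 'b) pre_digraph \<Rightarrow> 'a list \<Rightarrow> real mat" where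
  "degree_mat G vs = mat (length vs) (length vs)
     (\<lambda>(i, j). if i = j then real (out_degree G (vs ! i)) else 0)"

definition laplacian_mat :: "('a, 'b) pre_digraph \<Rightarrow> 'a list \<Rightarrow> real mat" where
  "laplacian_mat G vs = degree_mat G vs - adjacency_mat G vs"

definition laplacian_eigenvalues :: "('a, 'b) pre_digraph \<Rightarrow> 'a list \<Rightarrow> real multiset" where
  "laplacian_eigenvalues G vs = proots (char_poly (laplacian_mat G vs))"

definition laplacian_count :: "('a, 'b) pre_digraph \<Rightarrow> 'a list \<Rightarrow> real set \<Rightarrow> nat" where
  "laplacian_count G vs I = size {# x \<in># laplacian_eigenvalues G vs. x \<in> I #}"

text \<open>
  The distance is the least cost of a walk when every arc costs 1; it is \<open>\<infinity>\<close> if there is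
  no walk.
\<close>

definition graph_dist :: "('a, 'b) pre_digraph \<Rightarrow> 'a \<Rightarrow> 'a \<Rightarrow> ereal" where
  "graph_dist G u v = wf_digraph.\<mu> G (\<lambda>_. 1) u v"

definition graph_diameter :: "('a, 'b) pre_digraph \<Rightarrow> ereal" where
  "graph_diameter G = Max ((\<lambda>(u, v). graph_dist G u v) ` (verts G \<times> verts G))"

end

theory Submission
  imports Defs "Jordan_Normal_Form.Schur_Decomposition"
begin

text \<open>
  Write \<open>m = n - d - 1\<close> for the number of vertices off a fixed diametral path \<open>P\<close>, so that the
  threshold is \<open>n - d = m + 1\<close>. By the Courant-Fischer principle
  (\<open>eigenvalue_count_le_constraints\<close>) at most \<open>N\<close> eigenvalues reach the threshold as soon as
  \<open>N\<close> linear constraints leave only vectors \<open>x\<close> whose Rayleigh quotient is below it; a vector that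
  attains the threshold is harmless unless it is an eigenvector. Spend \<open>m\<close> constraints on making
  \<open>x\<close> vanish off \<open>P\<close>. It remains to find three further constraints on the values
  \<open>g i\<close> of \<open>x\<close> along \<open>P\<close>, and only two when \<open>d \<le> 4\<close>.

  On vectors supported on the induced path \<open>P\<close>, the Laplacian of the graph acts as the Laplacian of
  the path plus the diagonal matrix that counts the neighbours off \<open>P\<close>. Every vertex off \<open>P\<close>
  adds at most 1 to each diagonal entry and exactly 1 to the threshold. Hence all but three
  of them can be discarded, and the threshold becomes 4. As \<open>P\<close> is a shortest path, a vertex off \<open>P\<close>
  sees at most three consecutive vertices of \<open>P\<close>, a window with some centre \<open>c\<close>. Since
  \<open>4 I\<close> minus the path Laplacian is the form \<open>(\<Sum>i<d. (g i + g (i + 1))\<^sup>2) + 2 (g 0)\<^sup>2 + 2 (g d)\<^sup>2\<close>,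
  the task is to dominate the sum of \<open>(g i)\<^sup>2\<close> over three windows by this form.

  If \<open>g\<close> vanishes at the centre \<open>c\<close>, the window sum is \<open>(g (c - 1))\<^sup>2 + (g (c + 1))\<^sup>2\<close>, and these
  are just the terms of the two edges at \<open>c\<close>; so three distinct centres are the right zeros, and
  coinciding centres need a small change (\<open>three_zeros_dominate\<close>). For \<open>d \<le> 4\<close> two constraints
  can be given explicitly (\<open>two_constraints_suffice\<close>). The remaining terms \<open>2 (g 0)\<^sup>2 + 2 (g d)\<^sup>2\<close>
  settle the case of equality: it forces \<open>g\<close> to vanish at an end of \<open>P\<close>, and an eigenvector
  supported on \<open>P\<close> that vanishes at an end is zero, because the eigenvalue equation is a three-term
  recurrence along \<open>P\<close>.
\<close>

section \<open>Eigenvalue counts of real symmetric matrices\<close>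

text \<open>
  A complex eigenvalue exists by the fundamental theorem of algebra. It is real, because the Hermitian
  form \<open>S\<close> of the eigenvector is real and equals the eigenvalue times the squared norm \<open>N\<close>.
\<close>

lemma real_symmetric_has_eigenvector:
  fixes A :: "real mat"
  assumes A: "A \<in> carrier_mat n n" and sym: "A\<^sup>T = A" and n: "0 < n"
  obtains v k where "v \<in> carrier_vec n" "v \<noteq> 0\<^sub>v n" "A *\<^sub>v v = k \<cdot>\<^sub>v v"
proof -
  let ?C = "map_mat complex_of_real A"
  have C: "?C \<in> carrier_mat n n" using A by simp
  have "degree (char_poly ?C) = n" using degree_monic_char_poly[OF C] by simp
  then have "\<not> constant (poly (char_poly ?C))" using n by (simp add: constant_degree)
  then obtain z where z: "poly (char_poly ?C) z = 0"
    using fundamental_theorem_of_algebra by blast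
  then have "eigenvalue ?C z" by (simp add: eigenvalue_root_char_poly[OF C])
  then obtain w where w: "w \<in> carrier_vec n" "w \<noteq> 0\<^sub>v n" "?C *\<^sub>v w = z \<cdot>\<^sub>v w"
    using A unfolding eigenvalue_def eigenvector_def by auto
  define S where "S = (\<Sum>i<n. \<Sum>j<n. cnj (w $ i) * (of_real (A $$ (i,j)) * w $ j))"
  define N where "N = (\<Sum>i<n. (cmod (w $ i))\<^sup>2)"
  have symE: "A $$ (i,j) = A $$ (j,i)" if "i < n" "j < n" for i j
    using arg_cong[OF sym, of "\<lambda>M. M $$ (i,j)"] A that by simp
  have "cnj S = (\<Sum>i<n. \<Sum>j<n. w $ i * (of_real (A $$ (i,j)) * cnj (w $ j)))"
    by (simp add: S_def)
  also have "\<dots> = (\<Sum>j<n. \<Sum>i<n. w $ i * (of_real (A $$ (i,j)) * cnj (w $ j)))"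
    by (rule sum.swap)
  also have "\<dots> = S" unfolding S_def
    by (intro sum.cong refl) (simp add: symE mult_ac)
  finally have "S \<in> \<real>" by (simp add: Reals_cnj_iff)
  moreover have "S = z * of_real N"
  proof -
    have "(\<Sum>j<n. of_real (A $$ (i,j)) * w $ j) = z * w $ i" if "i < n" for i
      using arg_cong[OF w(3), of "\<lambda>u. u $ i"] that A w(1)
      by (simp add: scalar_prod_def atLeast0LessThan)
    then have "S = (\<Sum>i<n. cnj (w $ i) * (z * w $ i))"
      unfolding S_def by (intro sum.cong refl) (simp flip: sum_distrib_left)
    also have "\<dots> = z * of_real N"
      unfolding N_def of_real_sum sum_distrib_left
      by (intro sum.cong refl) (simp add: complex_norm_square mult_ac del: of_real_power)
    finally show ?thesis .
  qed
  moreover have "N \<noteq> 0"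
  proof
    assume "N = 0"
    then have "\<forall>i<n. w $ i = 0" unfolding N_def by (subst (asm) sum_nonneg_eq_0_iff) auto
    then have "w = 0\<^sub>v n" using w(1) by (intro eq_vecI) auto
    then show False using w(2) by simp
  qed
  ultimately have "z \<in> \<real>"
    by (metis Reals_of_real Reals_divide nonzero_mult_div_cancel_right of_real_eq_0_iff)
  then obtain k where k: "z = of_real k" by (auto elim: Reals_cases)
  have "of_real (poly (char_poly A) k) = (0 :: complex)"
    using z unfolding k of_real_hom.char_poly_hom[OF A] by simp
  then have "eigenvalue A k" by (simp add: eigenvalue_root_char_poly[OF A])
  then show ?thesis using that A unfolding eigenvalue_def eigenvector_def by auto
qed

text \<open>
  Gram-Schmidt, started at \<open>v\<close> and normalised.
\<close>

lemma orthogonal_matrix_with_first_column: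
  fixes v :: "real vec"
  assumes v: "v \<in> carrier_vec n" "v \<noteq> 0\<^sub>v n"
  obtains W c where "W \<in> carrier_mat n n" "W\<^sup>T * W = 1\<^sub>m n" "col W 0 = c \<cdot>\<^sub>v v"
proof -
  interpret cof_vec_space n "TYPE(real)" .
  have n: "0 < n" using v by (cases n) (auto intro!: eq_vecI)
  define b where "b = basis_completion v"
  define ws where "ws = gram_schmidt n b"
  note bc = basis_completion[OF v, folded b_def]
  from gram_schmidt_result[OF bc(2) bc(4) bc(5) ws_def] bc(6)
  have ws: "set ws \<subseteq> carrier_vec n" "corthogonal ws" "length ws = n" by auto
  obtain us where "b = v # us" using bc(6,7) n by (cases b) auto
  then have "hd ws = v" unfolding ws_def using gram_schmidt_hd[OF v(1)] by simp
  then have ws0: "ws ! 0 = v" using ws(3) n by (metis hd_conv_nth list.size(3) less_not_refl)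
  define us where "us = map (\<lambda>w. (1 / sqrt (w \<bullet> w)) \<cdot>\<^sub>v w) ws"
  define W where "W = mat_of_cols n us"
  have us: "set us \<subseteq> carrier_vec n" "length us = n" using ws by (auto simp: us_def)
  have wc: "ws ! i \<in> carrier_vec n" if "i < n" for i using ws that by auto
  have orth: "(ws ! i \<bullet> ws ! j = 0) = (i \<noteq> j)" if "i < n" "j < n" for i j
    using corthogonalD[OF ws(2), of i j] that ws(3)
    by (simp add: conjugate_real_def conjugate_vec_def)
  have pos: "0 < ws ! i \<bullet> ws ! i" if "i < n" for i
  proof -
    have "0 \<le> ws ! i \<bullet> ws ! i" by (auto simp: scalar_prod_def intro: sum_nonneg)
    then show ?thesis using orth[OF that that] by simp
  qed
  have W: "W \<in> carrier_mat n n" using us(2) by (auto simp: W_def)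
  have "W\<^sup>T * W = 1\<^sub>m n"
  proof (rule eq_matI)
    fix i j assume "i < dim_row (1\<^sub>m n :: real mat)" "j < dim_col (1\<^sub>m n :: real mat)"
    then have ij: "i < n" "j < n" by auto
    have "(W\<^sup>T * W) $$ (i,j) = us ! i \<bullet> us ! j"
      using ij W us by (simp add: W_def subset_iff)
    also have "\<dots> = (1 / sqrt (ws ! i \<bullet> ws ! i)) * (1 / sqrt (ws ! j \<bullet> ws ! j)) * (ws ! i \<bullet> ws ! j)"
      using ij ws(3) wc
      by (simp add: us_def smult_scalar_prod_distrib[of _ n] scalar_prod_smult_distrib[of _ n])
    also have "\<dots> = 1\<^sub>m n $$ (i,j)"
    proof (cases "i = j")
      case True
      then show ?thesis using pos[OF ij(1)] ij by (simp add: field_simps)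
    next
      case False
      then show ?thesis using orth[OF ij] ij by simp
    qed
    finally show "(W\<^sup>T * W) $$ (i,j) = 1\<^sub>m n $$ (i,j)" .
  qed (use W in auto)
  moreover have "col W 0 = (1 / sqrt (v \<bullet> v)) \<cdot>\<^sub>v v"
    using n us ws ws0 v by (simp add: W_def us_def)
  ultimately show ?thesis using that W by blast
qed

text \<open>
  Deflation: in an orthonormal basis that starts with an eigenvector, a symmetric matrix splits into a
  \<open>1 \<times> 1\<close> block and a smaller symmetric block.
\<close>

theorem real_symmetric_diagonalization:
  fixes A :: "real mat"
  assumes "A \<in> carrier_mat n n" and "A\<^sup>T = A"
  shows "\<exists>P D. P \<in> carrier_mat n n \<and> D \<in> carrier_mat n n \<and> diagonal_mat D \<and>
    P\<^sup>T * P = 1\<^sub>m n \<and> A = P * D * P\<^sup>T"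
  using assms
proof (induction n arbitrary: A)
  case 0
  then have "A = 1\<^sub>m 0 * A * (1\<^sub>m 0)\<^sup>T" by (intro eq_matI) auto
  moreover have "diagonal_mat A" using 0 by (auto simp: diagonal_mat_def)
  ultimately show ?case using 0 by (intro exI[of _ "1\<^sub>m 0"] exI[of _ A]) auto
next
  case (Suc n A)
  note A = Suc.prems(1)
  obtain v k where v: "v \<in> carrier_vec (Suc n)" "v \<noteq> 0\<^sub>v (Suc n)" and ev: "A *\<^sub>v v = k \<cdot>\<^sub>v v"
    using real_symmetric_has_eigenvector[OF Suc.prems] by auto
  obtain W c where W: "W \<in> carrier_mat (Suc n) (Suc n)" and WW: "W\<^sup>T * W = 1\<^sub>m (Suc n)"
    and W0: "col W 0 = c \<cdot>\<^sub>v v"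
    using orthogonal_matrix_with_first_column[OF v] .
  have Wt: "W\<^sup>T \<in> carrier_mat (Suc n) (Suc n)" using W by simp
  have WW': "W * W\<^sup>T = 1\<^sub>m (Suc n)" using mat_mult_left_right_inverse[OF Wt W WW] .
  define B where "B = W\<^sup>T * A * W"
  have B: "B \<in> carrier_mat (Suc n) (Suc n)" using A W unfolding B_def by auto
  have Bsym: "B\<^sup>T = B"
    unfolding B_def using A W Suc.prems(2)
    by (simp add: transpose_mult[of _ "Suc n" "Suc n" _ "Suc n"] assoc_mult_mat[of _ "Suc n" "Suc n" _ "Suc n" _ "Suc n"])
  have B0: "B $$ (i,0) = (if i = 0 then k else 0)" if i: "i < Suc n" for i
  proof -
    have "A *\<^sub>v col W 0 = k \<cdot>\<^sub>v col W 0"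
      unfolding W0 using A v(1) ev by (simp add: mult_mat_vec smult_smult_assoc mult.commute)
    moreover have "col B 0 = W\<^sup>T *\<^sub>v (A *\<^sub>v col W 0)"
    proof -
      have "B = W\<^sup>T * (A * W)" unfolding B_def by (rule assoc_mult_mat[OF Wt A W])
      then have "col B 0 = W\<^sup>T *\<^sub>v col (A * W) 0"
        using col_mult2[OF Wt mult_carrier_mat[OF A W]] by simp
      then show ?thesis using col_mult2[OF A W] by simp
    qed
    ultimately have "col B 0 = k \<cdot>\<^sub>v (W\<^sup>T *\<^sub>v col W 0)"
      using mult_mat_vec[OF Wt, of "col W 0" k] W by auto
    also have "W\<^sup>T *\<^sub>v col W 0 = col (W\<^sup>T * W) 0"
      by (rule col_mult2[OF Wt W, symmetric]) simp
    finally have "col B 0 = k \<cdot>\<^sub>v col (1\<^sub>m (Suc n)) 0" unfolding WW .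
    then have "col B 0 $ i = (k \<cdot>\<^sub>v col (1\<^sub>m (Suc n)) 0) $ i" by simp
    then show ?thesis using i B by (simp split: if_splits)
  qed
  have B0': "B $$ (0,i) = (if i = 0 then k else 0)" if i: "i < Suc n" for i
    using arg_cong[OF Bsym, of "\<lambda>M. M $$ (0,i)"] B0[OF i] B i by simp
  define A' where "A' = mat n n (\<lambda>(i,j). B $$ (Suc i, Suc j))"
  have A': "A' \<in> carrier_mat n n" by (simp add: A'_def)
  have "A'\<^sup>T = A'"
  proof (rule eq_matI)
    fix i j assume "i < dim_row A'" "j < dim_col A'"
    then have ij: "i < n" "j < n" using A' by auto
    show "A'\<^sup>T $$ (i,j) = A' $$ (i,j)"
      using arg_cong[OF Bsym, of "\<lambda>M. M $$ (Suc i, Suc j)"] B ij by (simp add: A'_def)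
  qed (use A' in auto)
  from Suc.IH[OF A' this] obtain P D where P: "P \<in> carrier_mat n n" and D: "D \<in> carrier_mat n n"
    and diag: "diagonal_mat D" and PP: "P\<^sup>T * P = 1\<^sub>m n" and A'_eq: "A' = P * D * P\<^sup>T"
    by blast
  let ?K = "mat 1 1 (\<lambda>_. k)"
  define E where "E X Y = four_block_mat X (0\<^sub>m 1 n) (0\<^sub>m n 1) Y" for X Y :: "real mat"
  have E_mult: "E X Y * E X' Y' = E (X * X') (Y * Y')"
    if "X \<in> carrier_mat 1 1" "X' \<in> carrier_mat 1 1" "Y \<in> carrier_mat n n" "Y' \<in> carrier_mat n n"
    for X Y X' Y'
    using that unfolding E_def
    by (subst mult_four_block_mat[of _ 1 1 _ n _ n _ _ 1 _ n]) auto
  have E_T: "(E X Y)\<^sup>T = E X\<^sup>T Y\<^sup>T" if "X \<in> carrier_mat 1 1" "Y \<in> carrier_mat n n" for X Y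
    unfolding E_def using that by (subst transpose_four_block_mat[of _ 1 1 _ n _ n]) auto
  have E_carrier: "E X Y \<in> carrier_mat (Suc n) (Suc n)"
    if "X \<in> carrier_mat 1 1" "Y \<in> carrier_mat n n" for X Y
    using four_block_carrier_mat[OF that] unfolding E_def by simp
  have B_eq: "B = E ?K A'"
  proof (rule eq_matI)
    fix i j assume "i < dim_row (E ?K A')" "j < dim_col (E ?K A')"
    then have ij: "i < Suc n" "j < Suc n" using E_carrier[of ?K A'] A' by auto
    then show "B $$ (i,j) = E ?K A' $$ (i,j)"
      using B0[OF ij(1)] B0'[OF ij(2)] A' by (auto simp: E_def A'_def)
  qed (use B E_carrier[of ?K A'] A' in auto)
  define Q where "Q = E (1\<^sub>m 1) P"
  have Q: "Q \<in> carrier_mat (Suc n) (Suc n)" unfolding Q_def using P by (intro E_carrier) auto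
  have "E (1\<^sub>m 1) (1\<^sub>m n) = (1\<^sub>m (Suc n) :: real mat)"
    unfolding E_def by (rule eq_matI) auto
  then have QQ: "Q\<^sup>T * Q = 1\<^sub>m (Suc n)"
    unfolding Q_def using P PP by (simp add: E_T E_mult)
  have Beq2: "B = Q * E ?K D * Q\<^sup>T"
    unfolding B_eq A'_eq Q_def using P D by (simp add: E_T E_mult)
  have ED: "E ?K D \<in> carrier_mat (Suc n) (Suc n)" using D by (intro E_carrier) auto
  note assoc = assoc_mult_mat[of _ "Suc n" "Suc n" _ "Suc n" _ "Suc n"]
  have "A = W * W\<^sup>T * A * (W * W\<^sup>T)" unfolding WW' using A by simp
  also have "\<dots> = W * B * W\<^sup>T" unfolding B_def using A W by (simp add: assoc)
  also have "\<dots> = (W * Q) * E ?K D * (W * Q)\<^sup>T"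
    unfolding Beq2 using W Q ED by (simp add: assoc transpose_mult[OF W Q])
  finally have "A = (W * Q) * E ?K D * (W * Q)\<^sup>T" .
  moreover have "(W * Q)\<^sup>T * (W * Q) = 1\<^sub>m (Suc n)"
  proof -
    have "(W * Q)\<^sup>T * (W * Q) = Q\<^sup>T * ((W\<^sup>T * W) * Q)"
      using W Q by (simp add: assoc transpose_mult[OF W Q])
    then show ?thesis unfolding WW using Q QQ by simp
  qed
  moreover have "diagonal_mat (E ?K D)"
    using diag D unfolding diagonal_mat_def E_def by auto
  ultimately show ?case using W Q ED by (intro exI[of _ "W * Q"] exI[of _ "E ?K D"]) auto
qed

text \<open>
  Padding the system with zero rows makes it square and singular.
\<close>

lemma underdetermined_system_has_solution:
  fixes rs :: "'a::field vec list"
  assumes rs: "set rs \<subseteq> carrier_vec n" and len: "length rs < n"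
  obtains x where "x \<in> carrier_vec n" "x \<noteq> 0\<^sub>v n" "\<And>r. r \<in> set rs \<Longrightarrow> r \<bullet> x = 0"
proof -
  define ps where "ps = rs @ replicate (n - length rs) (0\<^sub>v n)"
  define M where "M = mat_of_rows n ps"
  have ps: "length ps = n" "set ps \<subseteq> carrier_vec n" using rs len by (auto simp: ps_def)
  have M: "M \<in> carrier_mat n n" using ps(1) by (auto simp: M_def)
  have rowM: "row M i = ps ! i" if "i < n" for i
    using that ps unfolding M_def by (intro mat_of_rows_row) (auto simp: set_conv_nth)
  have "row M (n - 1) = 0\<^sub>v n"
    using len rowM[of "n - 1"] by (auto simp: ps_def nth_append)
  then have "det M = 0"
  proof -
    have "(\<Prod>i = 0..<n. M $$ (i, \<pi> i)) = 0" if "\<pi> permutes {0..<n}" for \<pi>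
    proof (rule prod_zero)
      have last: "n - 1 < n" using len by simp
      have "\<pi> (n - 1) < n" using permutes_in_image[OF that, of "n - 1"] last by simp
      then have "M $$ (n - 1, \<pi> (n - 1)) = row M (n - 1) $ \<pi> (n - 1)" using M last by simp
      with \<open>row M (n - 1) = 0\<^sub>v n\<close> \<open>\<pi> (n - 1) < n\<close> last
      show "\<exists>i\<in>{0..<n}. M $$ (i, \<pi> i) = 0" by (intro bexI[of _ "n - 1"]) auto
    qed simp
    then show ?thesis unfolding det_def'[OF M] by (intro sum.neutral) auto
  qed
  then obtain x where x: "x \<in> carrier_vec n" "x \<noteq> 0\<^sub>v n" "M *\<^sub>v x = 0\<^sub>v n"
    using det_0_iff_vec_prod_zero_field[OF M] by auto
  moreover have "r \<bullet> x = 0" if "r \<in> set rs" for r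
  proof -
    from that obtain i where i: "i < length rs" "r = rs ! i" by (auto simp: in_set_conv_nth)
    then have "r = row M i" using len by (simp add: rowM) (simp add: ps_def nth_append)
    then show ?thesis using arg_cong[OF x(3), of "\<lambda>u. u $ i"] i len M by simp
  qed
  ultimately show ?thesis using that by blast
qed

text \<open>
  One half of the Courant-Fischer principle. In the coordinates of an orthonormal eigenbasis, the
  constraints \<open>cs\<close> together with the vanishing of all coordinates with eigenvalue below \<open>\<theta>\<close> would
  be fewer than \<open>n\<close> equations if too many eigenvalues were at least \<open>\<theta>\<close>. A nonzero solution has
  Rayleigh quotient at least \<open>\<theta>\<close>, with equality only inside the eigenspace of \<open>\<theta>\<close>. This is why
  the hypothesis may tolerate equality for vectors that are not eigenvectors.
\<close>

theorem eigenvalue_count_le_constraints: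
  fixes A :: "real mat" and \<theta> :: real
  assumes A: "A \<in> carrier_mat n n" and sym: "A\<^sup>T = A" and cs: "set cs \<subseteq> carrier_vec n"
    and below: "\<And>x. x \<in> carrier_vec n \<Longrightarrow> x \<noteq> 0\<^sub>v n \<Longrightarrow> (\<And>c. c \<in> set cs \<Longrightarrow> c \<bullet> x = 0) \<Longrightarrow>
      x \<bullet> (A *\<^sub>v x) < \<theta> * (x \<bullet> x) \<or>
      x \<bullet> (A *\<^sub>v x) = \<theta> * (x \<bullet> x) \<and> A *\<^sub>v x \<noteq> \<theta> \<cdot>\<^sub>v x"
  shows "size {# t \<in># proots (char_poly A). \<theta> \<le> t #} \<le> length cs"
proof (rule ccontr)
  assume "\<not> ?thesis"
  then have many: "length cs < size {# t \<in># proots (char_poly A). \<theta> \<le> t #}" by simp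
  obtain P D where P: "P \<in> carrier_mat n n" and D: "D \<in> carrier_mat n n"
    and diag: "diagonal_mat D" and PP: "P\<^sup>T * P = 1\<^sub>m n" and A_eq: "A = P * D * P\<^sup>T"
    using real_symmetric_diagonalization[OF A sym] by blast
  have Pt: "P\<^sup>T \<in> carrier_mat n n" using P by simp
  have PP': "P * P\<^sup>T = 1\<^sub>m n" using mat_mult_left_right_inverse[OF Pt P PP] .
  have "similar_mat A D"
    unfolding similar_mat_def similar_mat_wit_def Let_def
    using A P D PP PP' A_eq by (intro exI[of _ P] exI[of _ "P\<^sup>T"]) auto
  then have "char_poly A = char_poly D" by (rule char_poly_similar)
  also have "\<dots> = (\<Prod>a\<leftarrow>diag_mat D. [:- a, 1:])"
    using D diag by (intro char_poly_upper_triangular) (auto simp: diagonal_mat_def)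
  finally have cp: "char_poly A = (\<Prod>a\<leftarrow>diag_mat D. [:- a, 1:])" .
  have "proots (\<Prod>a\<leftarrow>xs. [:- a, 1:]) = mset xs" for xs :: "real list"
  proof (induction xs)
    case (Cons a xs)
    have "(\<Prod>a\<leftarrow>xs. [:- a, 1:]) \<noteq> 0" by (auto simp: prod_list_zero_iff)
    then show ?case using Cons by (simp add: proots_mult del: mult_pCons_left)
  qed simp
  then have "{# t \<in># proots (char_poly A). \<theta> \<le> t #} = mset (filter (\<lambda>t. \<theta> \<le> t) (diag_mat D))"
    by (simp add: cp mset_filter)
  also have "filter (\<lambda>t. \<theta> \<le> t) (diag_mat D) = map (\<lambda>i. D $$ (i,i)) (filter (\<lambda>i. \<theta> \<le> D $$ (i,i)) [0..<n])"
    using D by (simp add: diag_mat_def filter_map o_def)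
  finally have count: "size {# t \<in># proots (char_poly A). \<theta> \<le> t #}
      = length (filter (\<lambda>i. \<theta> \<le> D $$ (i,i)) [0..<n])"
    by (simp only: size_mset length_map)
  \<comment> \<open>The indices of the eigenvalues below \<open>\<theta>\<close>: their eigenvectors give the additional constraints.\<close>
  define lows where "lows = filter (\<lambda>i. \<not> \<theta> \<le> D $$ (i,i)) [0..<n]"
  have "length (filter (\<lambda>i. \<theta> \<le> D $$ (i,i)) [0..<n]) + length lows = n"
    unfolding lows_def by (metis sum_length_filter_compl length_upt minus_nat.diff_0)
  with many count have len: "length (cs @ map (col P) lows) < n" by simp
  have "set (cs @ map (col P) lows) \<subseteq> carrier_vec n"
    using cs P by (auto simp: lows_def)
  then obtain x where x: "x \<in> carrier_vec n" "x \<noteq> 0\<^sub>v n"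
    and orth: "\<And>r. r \<in> set (cs @ map (col P) lows) \<Longrightarrow> r \<bullet> x = 0"
    using underdetermined_system_has_solution len by metis
  define y where "y = P\<^sup>T *\<^sub>v x"
  have y: "y \<in> carrier_vec n" unfolding y_def using mult_mat_vec_carrier[OF Pt x(1)] .
  have y0: "y $ i = 0" if "i < n" "D $$ (i,i) < \<theta>" for i
    using orth[of "col P i"] that P by (force simp: y_def lows_def)
  have x_eq: "x = P *\<^sub>v y"
    using PP' P x by (simp add: y_def flip: assoc_mult_mat_vec[of _ n n _ n])
  have isometry: "(P *\<^sub>v u) \<bullet> (P *\<^sub>v w) = u \<bullet> w" if "u \<in> carrier_vec n" "w \<in> carrier_vec n" for u w
  proof -
    have Pw: "P *\<^sub>v w \<in> carrier_vec n" and Pu: "P *\<^sub>v u \<in> carrier_vec n"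
      using P that by auto
    have "(P *\<^sub>v u) \<bullet> (P *\<^sub>v w) = (P *\<^sub>v w) \<bullet> (P *\<^sub>v u)"
      using comm_scalar_prod[OF Pu Pw] .
    also have "\<dots> = (P\<^sup>T *\<^sub>v (P *\<^sub>v w)) \<bullet> u"
      using transpose_vec_mult_scalar[OF P that(1) Pw] by simp
    also have "\<dots> = u \<bullet> (P\<^sup>T *\<^sub>v (P *\<^sub>v w))"
      using Pt Pw that by (intro comm_scalar_prod[of _ n]) auto
    also have "P\<^sup>T *\<^sub>v (P *\<^sub>v w) = w"
      using PP P that by (simp flip: assoc_mult_mat_vec[of _ n n _ n])
    finally show ?thesis .
  qed
  have Dy: "D *\<^sub>v y \<in> carrier_vec n" using mult_mat_vec_carrier[OF D y] .
  have Dyi: "(D *\<^sub>v y) $ i = D $$ (i,i) * y $ i" if i: "i < n" for i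
  proof -
    have "(D *\<^sub>v y) $ i = (\<Sum>j<n. D $$ (i,j) * y $ j)"
      using i D y by (simp add: scalar_prod_def atLeast0LessThan)
    also have "\<dots> = (\<Sum>j<n. if j = i then D $$ (i,i) * y $ i else 0)"
      using diag D i by (intro sum.cong) (auto simp: diagonal_mat_def)
    finally show ?thesis using i by simp
  qed
  have Ax: "A *\<^sub>v x = P *\<^sub>v (D *\<^sub>v y)"
    unfolding A_eq y_def using P D x by (simp add: assoc_mult_mat_vec[of _ n n _ n])
  have "x \<bullet> (A *\<^sub>v x) = y \<bullet> (D *\<^sub>v y)" unfolding Ax using x_eq isometry[OF y Dy] by simp
  then have xAx: "x \<bullet> (A *\<^sub>v x) = (\<Sum>i<n. D $$ (i,i) * (y $ i)\<^sup>2)"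
    using y D Dy by (simp add: scalar_prod_def atLeast0LessThan Dyi power2_eq_square mult_ac
      del: index_mult_mat_vec)
  have "x \<bullet> x = y \<bullet> y" using x_eq isometry[OF y y] by simp
  then have xx: "\<theta> * (x \<bullet> x) = (\<Sum>i<n. \<theta> * (y $ i)\<^sup>2)"
    using y by (simp add: scalar_prod_def atLeast0LessThan power2_eq_square sum_distrib_left)
  have gap: "x \<bullet> (A *\<^sub>v x) - \<theta> * (x \<bullet> x) = (\<Sum>i<n. (D $$ (i,i) - \<theta>) * (y $ i)\<^sup>2)"
    unfolding xAx xx by (simp add: sum_subtractf left_diff_distrib)
  have nonneg: "0 \<le> (D $$ (i,i) - \<theta>) * (y $ i)\<^sup>2" if "i < n" for i
    using y0[OF that] by (cases "D $$ (i,i) < \<theta>") auto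
  then have ge: "\<theta> * (x \<bullet> x) \<le> x \<bullet> (A *\<^sub>v x)"
    using gap sum_nonneg[of "{..<n}" "\<lambda>i. (D $$ (i,i) - \<theta>) * (y $ i)\<^sup>2"] by auto
  have "A *\<^sub>v x = \<theta> \<cdot>\<^sub>v x" if eq: "x \<bullet> (A *\<^sub>v x) = \<theta> * (x \<bullet> x)"
  proof -
    have "\<forall>i\<in>{..<n}. (D $$ (i,i) - \<theta>) * (y $ i)\<^sup>2 = 0"
      using gap eq nonneg by (subst sum_nonneg_eq_0_iff[symmetric]) auto
    then have "D $$ (i,i) * y $ i = \<theta> * y $ i" if "i < n" for i using that by auto
    then have "D *\<^sub>v y = \<theta> \<cdot>\<^sub>v y"
      using D y Dyi by (intro eq_vecI) (auto simp del: index_mult_mat_vec)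
    then show ?thesis using Ax x_eq mult_mat_vec[OF P y] by metis
  qed
  then show False using below[OF x] orth ge by force
qed

section \<open>Three windows on a path\<close>

definition window :: "nat \<Rightarrow> nat \<Rightarrow> real" where
  "window c i = of_bool (c \<le> i + 1 \<and> i \<le> c + 1)"

text \<open>
  The quadratic form of the path Laplacian plus \<open>diag t\<close> minus \<open>4 I\<close>, see \<open>path_form_alt\<close>. It is
  written with the signless edge terms because these are what has to compensate \<open>t\<close>.
\<close>

definition path_form :: "nat \<Rightarrow> (nat \<Rightarrow> real) \<Rightarrow> (nat \<Rightarrow> real) \<Rightarrow> real" where
  "path_form d t g = (\<Sum>i\<le>d. t i * (g i)\<^sup>2) - 2 * (g 0)\<^sup>2 - 2 * (g d)\<^sup>2
     - (\<Sum>i<d. (g i + g (i + 1))\<^sup>2)"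

text \<open>
  Prescribed zeros may leave the form only semidefinite, but vanishing of \<open>g\<close> at an end of the path is
  enough to exclude eigenvectors later (\<open>three_term_recurrence_vanishes\<close>).
\<close>

definition almost_negative :: "nat \<Rightarrow> (nat \<Rightarrow> real) \<Rightarrow> (nat \<Rightarrow> real) \<Rightarrow> bool" where
  "almost_negative d t g \<longleftrightarrow> path_form d t g \<le> 0 \<and> (path_form d t g = 0 \<longrightarrow> g 0 = 0 \<or> g d = 0)"

text \<open>
  An edge from a zero \<open>z \<in> Z\<close> to a neighbour \<open>i\<close> contributes exactly \<open>(g i)\<^sup>2\<close> to the edge terms.
  So the weight \<open>t i\<close> is paid for as soon as it does not exceed the number of neighbours of
  \<open>i\<close> in \<open>Z\<close>, and the end terms of the form are left over.
\<close>

lemma almost_negative_if_zeros_dominate: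
  assumes Z: "Z \<subseteq> {..d}" "\<And>i. i \<in> Z \<Longrightarrow> g i = 0"
    and t: "\<And>i. i \<le> d \<Longrightarrow> i \<notin> Z \<Longrightarrow> t i \<le> of_bool (0 < i \<and> i - 1 \<in> Z) + of_bool (i + 1 \<in> Z)"
  shows "almost_negative d t g"
proof -
  let ?l = "\<lambda>i. of_bool (0 < i \<and> i - 1 \<in> Z) * (g i)\<^sup>2"
  let ?r = "\<lambda>i. of_bool (i + 1 \<in> Z) * (g i)\<^sup>2"
  have "t i * (g i)\<^sup>2 \<le> ?l i + ?r i" if "i \<le> d" for i
  proof (cases "i \<in> Z")
    case False
    then show ?thesis unfolding distrib_right[symmetric]
      by (intro mult_right_mono t that) auto
  qed (simp add: Z)
  then have "(\<Sum>i\<le>d. t i * (g i)\<^sup>2) \<le> (\<Sum>i\<le>d. ?l i) + (\<Sum>i\<le>d. ?r i)"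
    unfolding sum.distrib[symmetric] by (intro sum_mono) auto
  also have "(\<Sum>i\<le>d. ?l i) = (\<Sum>i<d. of_bool (i \<in> Z) * (g (i + 1))\<^sup>2)"
    by (subst lessThan_Suc_atMost[symmetric], subst sum.lessThan_Suc_shift) simp
  also have "(\<Sum>i\<le>d. ?r i) = (\<Sum>i<d. ?r i)"
    using Z(1) by (auto simp flip: lessThan_Suc_atMost)
  also have "(\<Sum>i<d. of_bool (i \<in> Z) * (g (i + 1))\<^sup>2) + \<dots> \<le> (\<Sum>i<d. (g i + g (i + 1))\<^sup>2)"
    unfolding sum.distrib[symmetric] using Z(2) by (intro sum_mono) auto
  finally have le: "path_form d t g \<le> - 2 * (g 0)\<^sup>2 - 2 * (g d)\<^sup>2"
    by (simp add: path_form_def)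
  have sq: "0 \<le> (g 0)\<^sup>2" "0 \<le> (g d)\<^sup>2" by auto
  have "(g 0)\<^sup>2 = 0" if "path_form d t g = 0" using le sq that by linarith
  moreover have "path_form d t g \<le> 0" using le sq by linarith
  ultimately show ?thesis unfolding almost_negative_def by auto
qed

text \<open>
  Three distinct centres can serve as the zeros themselves: \<open>i\<close> lies in the window of a centre
  \<open>c \<noteq> i\<close> only if \<open>c\<close> is a neighbour of \<open>i\<close>. If a centre \<open>j\<close> occurs twice, a neighbour of \<open>j\<close> has
  weight 2 but only the one zero \<open>j\<close> next to it. Then both neighbours of \<open>j\<close> become zeros, and
  \<open>j\<close> itself, of weight 2, has two zeros next to it. The third zero is the third centre \<open>k\<close>, or
  \<open>j\<close> if \<open>k\<close> is too close: in that case the window of \<open>k\<close> overlaps that of \<open>j\<close> and reaches at most one vertex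
  beyond it, next to a zero.
\<close>

lemma three_zeros_dominate:
  fixes d :: nat
  assumes c: "c1 \<in> {1..<d}" "c2 \<in> {1..<d}" "c3 \<in> {1..<d}"
  obtains z1 z2 z3 where "z1 \<le> d" "z2 \<le> d" "z3 \<le> d"
    "\<And>i. i \<le> d \<Longrightarrow> i \<notin> {z1,z2,z3} \<Longrightarrow> window c1 i + window c2 i + window c3 i
      \<le> of_bool (0 < i \<and> i - 1 \<in> {z1,z2,z3}) + of_bool (i + 1 \<in> {z1,z2,z3})"
proof (cases "c1 \<noteq> c2 \<and> c1 \<noteq> c3 \<and> c2 \<noteq> c3")
  case True
  show ?thesis
  proof (rule that[of c1 c2 c3])
    fix i assume i: "i \<le> d" "i \<notin> {c1,c2,c3}"
    have split: "window c i = of_bool (0 < i \<and> i - 1 = c) + of_bool (i + 1 = c)" if "i \<noteq> c" for c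
      using that by (auto simp: window_def)
    have one: "of_bool (p \<and> x = c1) + of_bool (p \<and> x = c2) + of_bool (p \<and> x = c3)
        \<le> (of_bool (p \<and> x \<in> {c1,c2,c3}) :: real)" for p and x :: nat
      using True by (cases p; cases "x = c1"; cases "x = c2"; cases "x = c3") simp_all
    have "window c1 i + window c2 i + window c3 i
      = (of_bool (0 < i \<and> i - 1 = c1) + of_bool (0 < i \<and> i - 1 = c2) + of_bool (0 < i \<and> i - 1 = c3))
      + (of_bool (i + 1 = c1) + of_bool (i + 1 = c2) + of_bool (i + 1 = c3))"
      using i split[of c1] split[of c2] split[of c3] by (simp only: insert_iff) linarith
    also have "\<dots> \<le> of_bool (0 < i \<and> i - 1 \<in> {c1,c2,c3}) + of_bool (i + 1 \<in> {c1,c2,c3})"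
      using one[of "0 < i" "i - 1"] one[of True "i + 1"] by (intro add_mono) simp_all
    finally show "window c1 i + window c2 i + window c3 i
      \<le> of_bool (0 < i \<and> i - 1 \<in> {c1,c2,c3}) + of_bool (i + 1 \<in> {c1,c2,c3})" .
  qed (use c in auto)
next
  case False
  then consider "c1 = c2" | "c1 = c3" | "c2 = c3" by blast
  then obtain j k where jk: "1 \<le> j" "j < d" "1 \<le> k" "k < d"
    and sum: "\<And>i. window c1 i + window c2 i + window c3 i = 2 * window j i + window k i"
    using c by cases (auto simp: algebra_simps)
  define near where "near \<longleftrightarrow> k = j \<or> k = j + 1 \<or> k + 1 = j"
  define z where "z = (if near then j else k)"
  show ?thesis
  proof (rule that[of "j - 1" "j + 1" z])
    fix i assume i: "i \<le> d" "i \<notin> {j - 1, j + 1, z}"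
    let ?Z = "{j - 1, j + 1, z}"
    let ?L = "of_bool (0 < i \<and> i - 1 \<in> ?Z) :: real"
    let ?R = "of_bool (i + 1 \<in> ?Z) :: real"
    have "2 * window j i + window k i \<le> ?L + ?R"
    proof (cases "i = j")
      case True
      with i have "\<not> near" by (auto simp: z_def)
      then have "window k i = 0" using True by (auto simp: window_def near_def)
      moreover have "?L = 1" "?R = 1" using True jk by auto
      ultimately show ?thesis using True by (simp add: window_def)
    next
      case False
      then have "window j i = 0" using i by (auto simp: window_def)
      moreover have "window k i = 0 \<or> window k i = 1 \<and> (?L = 1 \<or> ?R = 1)"
      proof (cases "window k i = 0")
        case nz: False
        then have ki: "k \<le> i + 1" "i \<le> k + 1" and one: "window k i = 1"
          by (auto simp: window_def split: if_splits)
        show ?thesis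
        proof (cases near)
          case True
          have "i \<noteq> j - 1" "i \<noteq> j + 1" using i by simp_all
          with True ki False have "i - 1 = j + 1 \<and> 0 < i \<or> i + 1 = j - 1"
            unfolding near_def by auto
          then show ?thesis using one by auto
        next
          case False
          then have z: "z = k" by (simp add: z_def)
          then have "i \<noteq> k" using i by simp
          with ki have "i - 1 = k \<and> 0 < i \<or> i + 1 = k" by auto
          then show ?thesis using one z by auto
        qed
      qed simp
      ultimately show ?thesis by auto
    qed
    then show "window c1 i + window c2 i + window c3 i \<le> ?L + ?R" unfolding sum .
  qed (use jk in \<open>auto simp: z_def\<close>)
qed

lemma three_constraints_suffice:
  assumes "c1 \<in> {1..<d}" "c2 \<in> {1..<d}" "c3 \<in> {1..<d}"
  shows "\<exists>cs. length cs = 3 \<and> (\<forall>g. (\<forall>c\<in>set cs. (\<Sum>i\<le>d. c i * g i) = 0) \<longrightarrow>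
    almost_negative d (\<lambda>i. window c1 i + window c2 i + window c3 i) g)"
proof -
  obtain z1 z2 z3 where z: "z1 \<le> d" "z2 \<le> d" "z3 \<le> d"
    and dom: "\<And>i. i \<le> d \<Longrightarrow> i \<notin> {z1,z2,z3} \<Longrightarrow> window c1 i + window c2 i + window c3 i
      \<le> of_bool (0 < i \<and> i - 1 \<in> {z1,z2,z3}) + of_bool (i + 1 \<in> {z1,z2,z3})"
    using three_zeros_dominate[OF assms] by blast
  let ?e = "\<lambda>z i. if i = z then 1 else 0 :: real"
  have e: "(\<Sum>i\<le>d. ?e z i * g i) = g z" if "z \<le> d" for z and g :: "nat \<Rightarrow> real"
    using that by (simp add: of_bool_def if_distrib[of "\<lambda>x. x * _"] cong: if_cong)
  have "almost_negative d (\<lambda>i. window c1 i + window c2 i + window c3 i) g"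
    if "\<forall>c\<in>set (map ?e [z1,z2,z3]). (\<Sum>i\<le>d. c i * g i) = 0" for g
  proof (rule almost_negative_if_zeros_dominate[OF _ _ dom])
    show "g i = 0" if "i \<in> {z1,z2,z3}" for i
      using \<open>\<forall>c\<in>_. _\<close> e[OF z(1), of g] e[OF z(2), of g] e[OF z(3), of g] that
      by (auto simp del: sum.delta sum.delta')
  qed (use z in auto)
  then show ?thesis by (intro exI[of _ "map ?e [z1,z2,z3]"]) auto
qed

text \<open>
  On short paths the end terms of the form are strong enough to save one constraint.
  For \<open>d = 2\<close> the constant functions work. For \<open>d = 3\<close> the two inner vertices are zeros, and each window
  contains exactly one end; the end term 2 and the outer edge term at an end together absorb up to three
  windows. For \<open>d = 4\<close> two
  neighbouring zeros suffice if all windows are \<open>{0,1,2}\<close> or all are \<open>{2,3,4}\<close>; otherwise the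
  functions \<open>(p, q, 2q, q, r)\<close> make the form negative definite.
\<close>

lemma two_constraints_suffice:
  assumes c: "c1 \<in> {1..<d}" "c2 \<in> {1..<d}" "c3 \<in> {1..<d}" and d: "d \<in> {2,3,4}"
  shows "\<exists>cs. length cs = 2 \<and> (\<forall>g. (\<forall>c\<in>set cs. (\<Sum>i\<le>d. c i * g i) = 0) \<longrightarrow>
    almost_negative d (\<lambda>i. window c1 i + window c2 i + window c3 i) g)"
proof -
  note expand = eval_nat_numeral lessThan_Suc atMost_Suc
  let ?t = "\<lambda>i. window c1 i + window c2 i + window c3 i"
  let ?c = "\<lambda>xs i. xs ! i :: real"
  have squares: "almost_negative d ?t g"
    if "path_form d ?t g = - (a * (g 0)\<^sup>2 + b * (g d)\<^sup>2) - r" "0 \<le> a" "0 \<le> b" "0 \<le> r" "0 < a + b" for g a b r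
  proof -
    let ?p = "path_form d ?t g"
    have nonneg: "0 \<le> a * (g 0)\<^sup>2" "0 \<le> b * (g d)\<^sup>2" using that by auto
    then have "?p \<le> 0" using that(1,4) by linarith
    moreover have "g 0 = 0 \<or> g d = 0" if "?p = 0"
    proof -
      have "a * (g 0)\<^sup>2 = 0" "b * (g d)\<^sup>2 = 0"
        using nonneg \<open>0 \<le> r\<close> that \<open>?p = _ - r\<close> by linarith+
      then show ?thesis using \<open>0 < a + b\<close> by auto
    qed
    ultimately show ?thesis unfolding almost_negative_def by blast
  qed
  define w where "w g c = (\<Sum>i\<le>d. window c i * (g i)\<^sup>2)" for g and c :: nat
  have form: "path_form d ?t g = w g c1 + w g c2 + w g c3 - 2 * (g 0)\<^sup>2 - 2 * (g d)\<^sup>2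
      - (\<Sum>i<d. (g i + g (i + 1))\<^sup>2)" for g
    by (simp add: path_form_def w_def distrib_right sum.distrib)
  consider "d = 2" | "d = 3" | "d = 4" using d by auto
  then show ?thesis
  proof cases
    case 1
    have "almost_negative d ?t g"
      if "\<forall>c\<in>set (map ?c [[1,-1,0],[0,1,-1]]). (\<Sum>i\<le>d. c i * g i) = 0" for g
    proof -
      have g: "g 1 = g 0" "g 2 = g 0" using that 1 by (auto simp: expand)
      have "w g 1 = 3 * (g 0)\<^sup>2" using 1 g by (simp add: w_def window_def expand)
      moreover have "c1 = 1" "c2 = 1" "c3 = 1" using c 1 by auto
      ultimately have "path_form d ?t g = 9 * (g 0)\<^sup>2 - 4 * (g 0)\<^sup>2 - 2 * (2 * g 0)\<^sup>2"
        unfolding form using 1 g by (simp add: expand)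
      then show ?thesis by (intro squares[of _ 3 0 0]) (simp_all add: power_mult_distrib)
    qed
    then show ?thesis by (intro exI[of _ "map ?c [[1,-1,0],[0,1,-1]]"]) auto
  next
    case 2
    have "almost_negative d ?t g"
      if "\<forall>c\<in>set (map ?c [[0,1,0,0],[0,0,1,0]]). (\<Sum>i\<le>d. c i * g i) = 0" for g
    proof -
      have g: "g 1 = 0" "g 2 = 0" using that 2 by (auto simp: expand)
      have w: "w g c = of_bool (c = 1) * (g 0)\<^sup>2 + (1 - of_bool (c = 1)) * (g 3)\<^sup>2" if "c \<in> {1..<d}" for c
      proof -
        have "c = 1 \<or> c = 2" using that 2 by auto
        then show ?thesis using 2 g by (auto simp: w_def window_def expand)
      qed
      \<comment> \<open>The number of windows that contain the end 0; the other windows contain the end 3.\<close>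
      define a :: real where "a = of_bool (c1 = 1) + of_bool (c2 = 1) + of_bool (c3 = 1)"
      have "0 \<le> a" "a \<le> 3" by (auto simp: a_def)
      moreover have "path_form d ?t g = - ((3 - a) * (g 0)\<^sup>2 + a * (g d)\<^sup>2) - 0"
        unfolding form c[THEN w] using 2 g by (simp add: expand a_def algebra_simps)
      ultimately show ?thesis by (intro squares[of _ "3 - a" a 0]) auto
    qed
    then show ?thesis by (intro exI[of _ "map ?c [[0,1,0,0],[0,0,1,0]]"]) auto
  next
    case 3
    have c': "c = 1 \<or> c = 2 \<or> c = 3" if "c \<in> {1..<d}" for c using that 3 by auto
    consider "c1 = 1" "c2 = 1" "c3 = 1" | "c1 = 3" "c2 = 3" "c3 = 3"
      | "\<not> (c1 = 1 \<and> c2 = 1 \<and> c3 = 1)" "\<not> (c1 = 3 \<and> c2 = 3 \<and> c3 = 3)" by blast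
    then show ?thesis
    proof cases
      case 1
      have "almost_negative d ?t g"
        if "\<forall>c\<in>set (map ?c [[0,1,0,0,0],[0,0,1,0,0]]). (\<Sum>i\<le>d. c i * g i) = 0" for g
      proof -
        have g: "g 1 = 0" "g 2 = 0" using that 3 by (auto simp: expand)
        then have "w g 1 = (g 0)\<^sup>2" using 3 by (simp add: w_def window_def expand)
        then have "path_form d ?t g = - (0 * (g 0)\<^sup>2 + 2 * (g d)\<^sup>2) - ((g 3)\<^sup>2 + (g 3 + g 4)\<^sup>2)"
          unfolding form using 1 3 g by (simp add: expand)
        then show ?thesis by (intro squares[of _ 0 2 "(g 3)\<^sup>2 + (g 3 + g 4)\<^sup>2"]) auto
      qed
      then show ?thesis by (intro exI[of _ "map ?c [[0,1,0,0,0],[0,0,1,0,0]]"]) auto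
    next
      case 2
      have "almost_negative d ?t g"
        if "\<forall>c\<in>set (map ?c [[0,0,0,1,0],[0,0,1,0,0]]). (\<Sum>i\<le>d. c i * g i) = 0" for g
      proof -
        have g: "g 3 = 0" "g 2 = 0" using that 3 by (auto simp: expand)
        then have "w g 3 = (g 4)\<^sup>2" using 3 by (simp add: w_def window_def expand)
        then have "path_form d ?t g = - (2 * (g 0)\<^sup>2 + 0 * (g d)\<^sup>2) - ((g 1)\<^sup>2 + (g 0 + g 1)\<^sup>2)"
          unfolding form using 2 3 g by (simp add: expand)
        then show ?thesis by (intro squares[of _ 2 0 "(g 1)\<^sup>2 + (g 0 + g 1)\<^sup>2"]) auto
      qed
      then show ?thesis by (intro exI[of _ "map ?c [[0,0,0,1,0],[0,0,1,0,0]]"]) auto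
    next
      case 4: 3
      have "almost_negative d ?t g"
        if "\<forall>c\<in>set (map ?c [[0,1,0,-1,0],[0,2,-1,0,0]]). (\<Sum>i\<le>d. c i * g i) = 0" for g
      proof -
        have g: "g 3 = g 1" "g 2 = 2 * g 1" using that 3 by (auto simp: expand)
        have w: "w g c = of_bool (c = 1) * (g 0)\<^sup>2 + of_bool (c = 3) * (g 4)\<^sup>2
          + (6 - of_bool (c = 1) - of_bool (c = 3)) * (g 1)\<^sup>2" if "c \<in> {1..<d}" for c
          using c'[OF that] 3 g by (auto simp: w_def window_def expand power_mult_distrib)
        \<comment> \<open>The numbers of windows that contain the end 0 and the end 4; the form then depends only on them.\<close>
        define a :: real where "a = of_bool (c1 = 1) + of_bool (c2 = 1) + of_bool (c3 = 1)"
        define b :: real where "b = of_bool (c1 = 3) + of_bool (c2 = 3) + of_bool (c3 = 3)"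
        have range: "a \<in> {0,1,2}" "b \<in> {0,1,2}" using 4 by (auto simp: a_def b_def)
        define \<psi> where "\<psi> a p q = (3 - a) * p\<^sup>2 + 2 * p * q + (1 + a) * q\<^sup>2" for a p q :: real
        \<comment> \<open>\<open>\<psi>\<close> collects the terms of one half of the path; it is positive definite for fewer than three windows at that end.\<close>
        have form': "path_form d ?t g = - \<psi> a (g 0) (g 1) - \<psi> b (g d) (g 1)"
          unfolding form c[THEN w] using 3 g
          by (simp add: expand a_def b_def \<psi>_def algebra_simps power2_eq_square)
        have \<psi>: "p\<^sup>2 / 3 \<le> \<psi> a p q" if "a \<in> {0,1,2}" for a p q
        proof -
          have e: "\<psi> 0 p q - p\<^sup>2 / 3 = 5 / 3 * p\<^sup>2 + (p + q)\<^sup>2"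
            "\<psi> 1 p q - p\<^sup>2 / 3 = 7 / 6 * p\<^sup>2 + (p + 2 * q)\<^sup>2 / 2"
            "\<psi> 2 p q - p\<^sup>2 / 3 = (p\<^sup>2 + (p + 3 * q)\<^sup>2) / 3"
            by (simp_all add: \<psi>_def power2_eq_square field_simps)
          have "0 \<le> \<psi> 0 p q - p\<^sup>2 / 3" "0 \<le> \<psi> 1 p q - p\<^sup>2 / 3" "0 \<le> \<psi> 2 p q - p\<^sup>2 / 3"
            unfolding e by simp_all
          then show ?thesis using that by auto
        qed
        define r where "r = \<psi> a (g 0) (g 1) - (g 0)\<^sup>2 / 3 + (\<psi> b (g d) (g 1) - (g d)\<^sup>2 / 3)"
        have "0 \<le> r" using range[THEN \<psi>, of "g 0" "g 1"] range[THEN \<psi>, of "g d" "g 1"]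
          by (simp add: r_def)
        then show ?thesis
          by (intro squares[of _ "1/3" "1/3" r]) (simp_all add: form' r_def)
      qed
      then show ?thesis by (intro exI[of _ "map ?c [[0,1,0,-1,0],[0,2,-1,0,0]]"]) auto
    qed
  qed
qed

section \<open>Laplacians of graphs with a geodesic path\<close>

text \<open>
  The diagonal entry of the path Laplacian at \<open>i\<close> is \<open>of_bool (0 < i) + of_bool (i < d)\<close>.
\<close>

lemma path_form_alt:
  "path_form d t g = (\<Sum>i\<le>d. (of_bool (0 < i) + of_bool (i < d) - 4 + t i) * (g i)\<^sup>2)
     - (\<Sum>i\<le>d. g i * ((if 0 < i then g (i - 1) else 0) + (if i < d then g (i + 1) else 0)))"
proof -
  have shift: "(\<Sum>i\<le>d. if 0 < i then f i else 0) = (\<Sum>i<d. f (i + 1))" for f :: "nat \<Rightarrow> real"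
    by (subst lessThan_Suc_atMost[symmetric], subst sum.lessThan_Suc_shift) simp
  have cut: "(\<Sum>i\<le>d. if i < d then f i else 0) = (\<Sum>i<d. f i)" for f :: "nat \<Rightarrow> real"
    by (simp flip: lessThan_Suc_atMost)
  have first: "(\<Sum>i\<le>d. (g i)\<^sup>2) = (g 0)\<^sup>2 + (\<Sum>i<d. (g (i + 1))\<^sup>2)"
    by (subst lessThan_Suc_atMost[symmetric], subst sum.lessThan_Suc_shift) simp
  have last: "(\<Sum>i\<le>d. (g i)\<^sup>2) = (\<Sum>i<d. (g i)\<^sup>2) + (g d)\<^sup>2"
    by (simp flip: lessThan_Suc_atMost)
  have "(\<Sum>i\<le>d. (of_bool (0 < i) + of_bool (i < d) - 4 + t i) * (g i)\<^sup>2)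
      = (\<Sum>i\<le>d. if 0 < i then (g i)\<^sup>2 else 0) + (\<Sum>i\<le>d. if i < d then (g i)\<^sup>2 else 0)
        - 4 * (\<Sum>i\<le>d. (g i)\<^sup>2) + (\<Sum>i\<le>d. t i * (g i)\<^sup>2)"
    unfolding sum_distrib_left sum.distrib[symmetric] sum_subtractf[symmetric]
    by (intro sum.cong) (auto simp: algebra_simps)
  moreover have "(\<Sum>i\<le>d. g i * ((if 0 < i then g (i - 1) else 0) + (if i < d then g (i + 1) else 0)))
      = (\<Sum>i\<le>d. if 0 < i then g i * g (i - 1) else 0) + (\<Sum>i\<le>d. if i < d then g i * g (i + 1) else 0)"
    unfolding sum.distrib[symmetric] by (intro sum.cong) (auto simp: algebra_simps)
  moreover have "(\<Sum>i<d. (g i + g (i + 1))\<^sup>2)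
      = (\<Sum>i<d. (g i)\<^sup>2) + (\<Sum>i<d. (g (i + 1))\<^sup>2) + 2 * (\<Sum>i<d. g i * g (i + 1))"
    unfolding sum_distrib_left sum.distrib[symmetric]
    by (intro sum.cong) (auto simp: power2_eq_square algebra_simps)
  ultimately show ?thesis
    unfolding path_form_def shift cut using first last by (simp add: mult.commute)
qed

text \<open>
  Starting from a zero at an end, the recurrence determines all further values to be zero.
\<close>

lemma three_term_recurrence_vanishes:
  fixes a g :: "nat \<Rightarrow> real"
  assumes rec: "\<And>i. i \<le> d \<Longrightarrow>
      a i * g i = (if 0 < i then g (i - 1) else 0) + (if i < d then g (i + 1) else 0)"
    and start: "g 0 = 0 \<or> g d = 0" and "i \<le> d"
  shows "g i = 0"
proof -
  have forward: "u i = 0" if rec: "\<And>i. i \<le> d \<Longrightarrow>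
      b i * u i = (if 0 < i then u (i - 1) else 0) + (if i < d then u (i + 1) else 0)"
    and "u 0 = 0" "i \<le> d" for b u :: "nat \<Rightarrow> real" and i
    using \<open>i \<le> d\<close>
  proof (induction i rule: less_induct)
    case (less i)
    show ?case
    proof (cases i)
      case 0
      then show ?thesis using \<open>u 0 = 0\<close> by simp
    next
      case (Suc j)
      have "u j = 0" using less Suc by simp
      moreover have "(if 0 < j then u (j - 1) else 0) = 0" using less Suc by simp
      ultimately show ?thesis using rec[of j] less.prems Suc by simp
    qed
  qed
  from start show ?thesis
  proof
    assume "g d = 0"
    have "g (d - (d - i)) = 0"
    proof (rule forward[of "\<lambda>i. a (d - i)" "\<lambda>i. g (d - i)"])
      fix i assume "i \<le> d"
      then show "a (d - i) * g (d - i)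
          = (if 0 < i then g (d - (i - 1)) else 0) + (if i < d then g (d - (i + 1)) else 0)"
        using rec[of "d - i"] by (cases "0 < i"; cases "i < d") (auto simp: Suc_diff_le)
    qed (use \<open>g d = 0\<close> in auto)
    then show ?thesis using \<open>i \<le> d\<close> by simp
  qed (rule forward[OF rec _ \<open>i \<le> d\<close>])
qed

text \<open>
  Vertices are identified with row indices, so that the enumeration of the vertices does not have to be
  carried through the argument. The entries are the intended ones for irreflexive \<open>E\<close>.
\<close>

definition graph_laplacian :: "nat \<Rightarrow> (nat \<Rightarrow> nat \<Rightarrow> bool) \<Rightarrow> real mat" where
  "graph_laplacian n E =
     mat n n (\<lambda>(i, j). (if i = j then real (card {k. E i k}) else 0) - of_bool (E i j))"

text \<open>
  A path \<open>p\<close> of length \<open>d\<close> on which the function \<open>h\<close> grows by 1 at each step, while \<open>h\<close> changes by at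
  most 1 along any edge; for instance, \<open>h\<close> is the distance from \<open>p 0\<close>. Such a level function
  certifies that \<open>p\<close> is a shortest path.
\<close>

locale geodesic =
  fixes n d :: nat and E :: "nat \<Rightarrow> nat \<Rightarrow> bool" and p :: "nat \<Rightarrow> nat" and h :: "nat \<Rightarrow> int"
  assumes E_less: "E i j \<Longrightarrow> i < n \<and> j < n"
    and E_sym: "E i j \<Longrightarrow> E j i"
    and E_irrefl: "\<not> E i i"
    and p_less: "i \<le> d \<Longrightarrow> p i < n"
    and p_edge: "i < d \<Longrightarrow> E (p i) (p (i + 1))"
    and h_p: "i \<le> d \<Longrightarrow> h (p i) = int i"
    and h_step: "E i j \<Longrightarrow> h i \<le> h j + 1"
begin

abbreviation "L \<equiv> graph_laplacian n E"
abbreviation "P \<equiv> p ` {..d}"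

lemma L_carrier: "L \<in> carrier_mat n n"
  by (simp add: graph_laplacian_def)

lemma L_symmetric: "L\<^sup>T = L"
  by (rule eq_matI) (auto simp: graph_laplacian_def dest: E_sym)

lemma p_inj: "inj_on p {..d}"
  by (rule inj_onI) (metis atMost_iff h_p of_nat_eq_iff)

lemma p_adjacent_iff:
  assumes "i \<le> d" "j \<le> d"
  shows "E (p i) (p j) \<longleftrightarrow> 0 < i \<and> j = i - 1 \<or> i < d \<and> j = i + 1"
proof
  assume edge: "E (p i) (p j)"
  have "int i \<le> int j + 1" "int j \<le> int i + 1"
    using h_step[OF edge] h_step[OF E_sym[OF edge]] assms by (auto simp: h_p)
  moreover have "i \<noteq> j" using edge E_irrefl by auto
  ultimately show "0 < i \<and> j = i - 1 \<or> i < d \<and> j = i + 1" using assms by linarith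
next
  assume "0 < i \<and> j = i - 1 \<or> i < d \<and> j = i + 1"
  then show "E (p i) (p j)" using p_edge[of i] E_sym[OF p_edge[of "i - 1"]] assms by auto
qed

text \<open>
  Two path vertices with a common neighbour are at most two levels apart. The centre is the successor
  of the lowest neighbour, moved down by one if that would be the end \<open>d\<close>.
\<close>

lemma path_neighbours_within_window:
  assumes "2 \<le> d"
  obtains c where "c \<in> {1..<d}" "\<And>i. i \<le> d \<Longrightarrow> of_bool (E (p i) w) \<le> window c i"
proof -
  define S where "S = {i. i \<le> d \<and> E (p i) w}"
  have fin: "finite S" by (simp add: S_def)
  have near: "i \<le> j + 2" if "i \<in> S" "j \<in> S" for i j
    using h_step[of "p i" w] h_step[of w "p j"] that E_sym[of "p j" w] by (auto simp: S_def h_p)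
  show ?thesis
  proof (cases "S = {}")
    case True
    then have "\<not> E (p i) w" if "i \<le> d" for i using that by (auto simp: S_def)
    then show ?thesis using assms by (intro that[of 1]) (auto simp: window_def)
  next
    case False
    define m where "m = Min S"
    have m: "m \<in> S" "\<And>i. i \<in> S \<Longrightarrow> m \<le> i" using fin False by (auto simp: m_def)
    define c where "c = min (m + 1) (d - 1)"
    show ?thesis
    proof (rule that[of c])
      show "c \<in> {1..<d}" using assms by (auto simp: c_def)
      fix i assume "i \<le> d"
      show "of_bool (E (p i) w) \<le> window c i"
      proof (cases "E (p i) w")
        case True
        then have "i \<in> S" using \<open>i \<le> d\<close> by (simp add: S_def)
        then have "m \<le> i" "i \<le> m + 2" using m near by auto
        then have "c \<le> i + 1 \<and> i \<le> c + 1" using \<open>i \<le> d\<close> unfolding c_def by auto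
        then show ?thesis by (simp add: window_def)
      qed (simp add: window_def)
    qed
  qed
qed

text \<open>
  Relative to the threshold \<open>n - d\<close>, the \<open>n - d - 4\<close> vertices outside the path and \<open>W\<close> can be
  taken to be adjacent to every path vertex; what is left of the threshold is 4.
\<close>

lemma degree_bound:
  assumes i: "i \<le> d" and w: "card W = 3" "W \<subseteq> {..<n} - P" and n: "d + 4 \<le> n"
  shows "real (card {k. E (p i) k}) - (real n - real d)
    \<le> of_bool (0 < i) + of_bool (i < d) - 4 + (\<Sum>w\<in>W. of_bool (E (p i) w))"
proof -
  have finW: "finite W" using w(1) by (intro card_ge_0_finite) simp
  let ?A = "{j. 0 < i \<and> j = i - 1} \<union> {j. i < d \<and> j = i + 1}"
  have A: "finite ?A" "card ?A \<le> of_bool (0 < i) + of_bool (i < d)"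
    by (auto intro!: order_trans[OF card_Un_le] add_mono)
  let ?R = "{..<n} - P - W"
  have "{k. E (p i) k} \<subseteq> p ` ?A \<union> ?R \<union> {w \<in> W. E (p i) w}"
    using p_adjacent_iff[OF i] E_less by fastforce
  then have "card {k. E (p i) k} \<le> card (p ` ?A \<union> ?R \<union> {w \<in> W. E (p i) w})"
    using A finW by (intro card_mono) auto
  also have "\<dots> \<le> card (p ` ?A) + card ?R + card {w \<in> W. E (p i) w}"
    by (intro order_trans[OF card_Un_le] add_mono card_Un_le) simp
  also have "card (p ` ?A) \<le> of_bool (0 < i) + of_bool (i < d)"
    using card_image_le[OF A(1)] A(2) by (rule order_trans)
  also have "card ?R = n - (d + 1) - 3"
  proof -
    have "card ({..<n} - P) = n - (d + 1)"
      using p_less by (subst card_Diff_subset) (auto simp: card_image[OF p_inj])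
    then show ?thesis using w finW by (subst card_Diff_subset) auto
  qed
  finally have "card {k. E (p i) k} \<le> of_bool (0 < i) + of_bool (i < d) + (n - (d + 1) - 3)
      + card {w \<in> W. E (p i) w}" by simp
  then have "real (card {k. E (p i) k}) \<le> real (of_bool (0 < i) + of_bool (i < d)
      + (n - (d + 1) - 3) + card {w \<in> W. E (p i) w})"
    by (simp only: of_nat_le_iff)
  moreover have "(\<Sum>w\<in>W. of_bool (E (p i) w)) = real (card {w \<in> W. E (p i) w})"
    using finW by (simp add: Int_def)
  moreover have "real (n - (d + 1) - 3) = real n - real d - 4" using n by simp
  ultimately show ?thesis unfolding of_nat_add of_nat_of_bool by linarith
qed

lemma sum_over_path:
  fixes f :: "nat \<Rightarrow> real"
  assumes "\<And>k. k < n \<Longrightarrow> k \<notin> P \<Longrightarrow> f k = 0"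
  shows "(\<Sum>k<n. f k) = (\<Sum>i\<le>d. f (p i))"
proof -
  have "(\<Sum>k<n. f k) = (\<Sum>k\<in>P. f k)"
    using assms p_less by (intro sum.mono_neutral_right) auto
  also have "\<dots> = (\<Sum>i\<le>d. f (p i))" by (simp add: sum.reindex[OF p_inj])
  finally show ?thesis .
qed

lemma L_on_path:
  assumes x: "x \<in> carrier_vec n" "\<And>k. k < n \<Longrightarrow> k \<notin> P \<Longrightarrow> x $ k = 0" and i: "i \<le> d"
  shows "(L *\<^sub>v x) $ p i = real (card {k. E (p i) k}) * x $ p i
    - ((if 0 < i then x $ p (i - 1) else 0) + (if i < d then x $ p (i + 1) else 0))"
proof -
  have "(L *\<^sub>v x) $ p i = (\<Sum>k<n. L $$ (p i, k) * x $ k)"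
    using x(1) L_carrier p_less[OF i] by (simp add: scalar_prod_def atLeast0LessThan)
  also have "\<dots> = (\<Sum>k<n. (if k = p i then real (card {k. E (p i) k}) * x $ p i else 0)
      - of_bool (E (p i) k) * x $ k)"
    using p_less[OF i] by (intro sum.cong) (auto simp: graph_laplacian_def left_diff_distrib)
  also have "\<dots> = real (card {k. E (p i) k}) * x $ p i - (\<Sum>k<n. of_bool (E (p i) k) * x $ k)"
    using p_less[OF i] by (simp add: sum_subtractf del: sum_of_bool_mult_eq)
  also have "(\<Sum>k<n. of_bool (E (p i) k) * x $ k) = (\<Sum>j\<le>d. of_bool (E (p i) (p j)) * x $ p j)"
    using x(2) by (intro sum_over_path) auto
  also have "\<dots> = (\<Sum>j\<le>d. (if j = i - 1 then (if 0 < i then x $ p (i - 1) else 0) else 0)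
      + (if j = i + 1 then (if i < d then x $ p (i + 1) else 0) else 0))"
    using i by (intro sum.cong) (auto simp: p_adjacent_iff[OF i])
  also have "\<dots> = (if 0 < i then x $ p (i - 1) else 0) + (if i < d then x $ p (i + 1) else 0)"
    using i by (auto simp: sum.distrib)
  finally show ?thesis .
qed

lemma quadratic_form_le_path_form:
  assumes x: "x \<in> carrier_vec n" "\<And>k. k < n \<Longrightarrow> k \<notin> P \<Longrightarrow> x $ k = 0"
    and w: "card W = 3" "W \<subseteq> {..<n} - P" and n: "d + 4 \<le> n"
    and t: "\<And>i. i \<le> d \<Longrightarrow> (\<Sum>w\<in>W. of_bool (E (p i) w)) \<le> t i"
  shows "x \<bullet> (L *\<^sub>v x) - (real n - real d) * (x \<bullet> x) \<le> path_form d t (\<lambda>i. x $ p i)"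
proof -
  let ?g = "\<lambda>i. x $ p i" and ?deg = "\<lambda>i. real (card {k. E (p i) k})"
  let ?nb = "\<lambda>i. (if 0 < i then ?g (i - 1) else 0) + (if i < d then ?g (i + 1) else 0)"
  have Lx: "L *\<^sub>v x \<in> carrier_vec n" using L_carrier x(1) by simp
  have dot: "x \<bullet> y = (\<Sum>i\<le>d. ?g i * y $ p i)" if "y \<in> carrier_vec n" for y
    using that x by (simp add: scalar_prod_def atLeast0LessThan) (intro sum_over_path, auto)
  have "x \<bullet> (L *\<^sub>v x) - (real n - real d) * (x \<bullet> x)
      = (\<Sum>i\<le>d. (?deg i - (real n - real d)) * (?g i)\<^sup>2) - (\<Sum>i\<le>d. ?g i * ?nb i)"
    unfolding dot[OF Lx] dot[OF x(1)] sum_distrib_left sum_subtractf[symmetric]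
    by (intro sum.cong refl, subst L_on_path[OF x]) (simp_all add: power2_eq_square algebra_simps)
  also have "(\<Sum>i\<le>d. (?deg i - (real n - real d)) * (?g i)\<^sup>2)
      \<le> (\<Sum>i\<le>d. (of_bool (0 < i) + of_bool (i < d) - 4 + t i) * (?g i)\<^sup>2)"
  proof (intro sum_mono mult_right_mono)
    fix i assume "i \<in> {..d}"
    then show "?deg i - (real n - real d) \<le> of_bool (0 < i) + of_bool (i < d) - 4 + t i"
      using degree_bound[OF _ w n, of i] t[of i] by simp
  qed simp
  finally show ?thesis unfolding path_form_alt by simp
qed

lemma eigenvector_on_path_vanishes:
  assumes x: "x \<in> carrier_vec n" "\<And>k. k < n \<Longrightarrow> k \<notin> P \<Longrightarrow> x $ k = 0"
    and ev: "L *\<^sub>v x = \<theta> \<cdot>\<^sub>v x" and "x $ p 0 = 0 \<or> x $ p d = 0"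
  shows "x = 0\<^sub>v n"
proof -
  have "x $ p i = 0" if "i \<le> d" for i
  proof (rule three_term_recurrence_vanishes[of d "\<lambda>i. real (card {k. E (p i) k}) - \<theta>" "\<lambda>i. x $ p i"])
    fix i assume i: "i \<le> d"
    have "(L *\<^sub>v x) $ p i = \<theta> * x $ p i" using ev x(1) p_less[OF i] by simp
    then show "(real (card {k. E (p i) k}) - \<theta>) * x $ p i
        = (if 0 < i then x $ p (i - 1) else 0) + (if i < d then x $ p (i + 1) else 0)"
      using L_on_path[OF x i] unfolding left_diff_distrib by linarith
  qed fact+
  then have "x $ k = 0" if "k < n" for k using x(2)[OF that] by (cases "k \<in> P") auto
  then show ?thesis using x(1) by (intro eq_vecI) auto
qed

text \<open>
  The constraints are the \<open>n - d - 1\<close> unit vectors off the path and the two or three constraints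
  along the path that the windows of three outside vertices require.
\<close>

theorem large_eigenvalue_count:
  assumes d: "2 \<le> d" and n: "d + 4 \<le> n"
  shows "size {# t \<in># proots (char_poly L). real n - real d \<le> t #}
    \<le> n - d - 1 + (if d \<le> 4 then 2 else 3)"
proof -
  have cardP: "card ({..<n} - P) = n - (d + 1)"
    using p_less by (subst card_Diff_subset) (auto simp: card_image[OF p_inj])
  then have "3 \<le> card ({..<n} - P)" using n by simp
  then obtain W where W: "W \<subseteq> {..<n} - P" "card W = 3"
    using obtain_subset_with_card_n by metis
  then obtain w1 w2 w3 where W_eq: "W = {w1, w2, w3}" "w1 \<noteq> w2" "w1 \<noteq> w3" "w2 \<noteq> w3"
    by (auto simp: card_3_iff)
  obtain c1 where c1: "c1 \<in> {1..<d}" "\<And>i. i \<le> d \<Longrightarrow> of_bool (E (p i) w1) \<le> window c1 i"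
    using path_neighbours_within_window[OF d] by blast
  obtain c2 where c2: "c2 \<in> {1..<d}" "\<And>i. i \<le> d \<Longrightarrow> of_bool (E (p i) w2) \<le> window c2 i"
    using path_neighbours_within_window[OF d] by blast
  obtain c3 where c3: "c3 \<in> {1..<d}" "\<And>i. i \<le> d \<Longrightarrow> of_bool (E (p i) w3) \<le> window c3 i"
    using path_neighbours_within_window[OF d] by blast
  let ?t = "\<lambda>i. window c1 i + window c2 i + window c3 i"
  have t: "(\<Sum>w\<in>W. of_bool (E (p i) w)) \<le> ?t i" if "i \<le> d" for i
    using c1(2)[OF that] c2(2)[OF that] c3(2)[OF that] W_eq(2-4)
    unfolding W_eq(1) by (simp del: sum_of_bool_eq)
  have "\<exists>bs. length bs = (if d \<le> 4 then 2 else 3) \<and>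
      (\<forall>g. (\<forall>b\<in>set bs. (\<Sum>i\<le>d. b i * g i) = 0) \<longrightarrow> almost_negative d ?t g)"
  proof (cases "d \<le> 4")
    case True
    then have "d \<in> {2,3,4}" using d by auto
    then show ?thesis using two_constraints_suffice[OF c1(1) c2(1) c3(1)] True by simp
  next
    case False
    then show ?thesis using three_constraints_suffice[OF c1(1) c2(1) c3(1)] by simp
  qed
  then obtain bs :: "(nat \<Rightarrow> real) list" where len: "length bs = (if d \<le> 4 then 2 else 3)"
    and bs: "\<And>g. (\<And>b. b \<in> set bs \<Longrightarrow> (\<Sum>i\<le>d. b i * g i) = 0) \<Longrightarrow> almost_negative d ?t g"
    by blast
  define path_vec where "path_vec b = vec n (\<lambda>k. \<Sum>i\<le>d. if p i = k then b i else 0)" for b :: "nat \<Rightarrow> real"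
  define outside where "outside = filter (\<lambda>k. k \<notin> P) [0..<n]"
  define cs where "cs = map path_vec bs @ map (unit_vec n) outside"
  have "length outside = card ({..<n} - P)"
    unfolding outside_def by (subst distinct_card[symmetric]) (auto intro!: arg_cong[of _ _ card])
  then have "length cs = n - d - 1 + (if d \<le> 4 then 2 else 3)"
    using len cardP by (simp add: cs_def)
  moreover have "size {# t \<in># proots (char_poly L). real n - real d \<le> t #} \<le> length cs"
  proof (rule eigenvalue_count_le_constraints[OF L_carrier L_symmetric])
    show "set cs \<subseteq> carrier_vec n" by (auto simp: cs_def path_vec_def)
    fix x :: "real vec"
    assume x: "x \<in> carrier_vec n" and x0: "x \<noteq> 0\<^sub>v n" and orth: "\<And>c. c \<in> set cs \<Longrightarrow> c \<bullet> x = 0"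
    have supp: "x $ k = 0" if "k < n" "k \<notin> P" for k
      using orth[of "unit_vec n k"] that x by (auto simp: cs_def outside_def)
    have "(\<Sum>i\<le>d. b i * x $ p i) = 0" if "b \<in> set bs" for b
    proof -
      have "path_vec b \<bullet> x = (\<Sum>k<n. \<Sum>i\<le>d. if p i = k then b i * x $ k else 0)"
        using x by (simp add: path_vec_def scalar_prod_def atLeast0LessThan sum_distrib_right
            if_distrib[of "\<lambda>y. y * _"] cong: if_cong)
      also have "\<dots> = (\<Sum>i\<le>d. \<Sum>k<n. if p i = k then b i * x $ k else 0)" by (rule sum.swap)
      also have "\<dots> = (\<Sum>i\<le>d. b i * x $ p i)"
        using p_less by (intro sum.cong) auto
      finally show ?thesis using orth[of "path_vec b"] that by (simp add: cs_def)
    qed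
    then have neg: "almost_negative d ?t (\<lambda>i. x $ p i)" by (rule bs)
    have le: "x \<bullet> (L *\<^sub>v x) - (real n - real d) * (x \<bullet> x) \<le> path_form d ?t (\<lambda>i. x $ p i)"
      using x supp W(2,1) n t by (rule quadratic_form_le_path_form)
    show "x \<bullet> (L *\<^sub>v x) < (real n - real d) * (x \<bullet> x) \<or>
      x \<bullet> (L *\<^sub>v x) = (real n - real d) * (x \<bullet> x) \<and> L *\<^sub>v x \<noteq> (real n - real d) \<cdot>\<^sub>v x"
    proof (cases "x \<bullet> (L *\<^sub>v x) < (real n - real d) * (x \<bullet> x)")
      case False
      then have "path_form d ?t (\<lambda>i. x $ p i) = 0" "x \<bullet> (L *\<^sub>v x) = (real n - real d) * (x \<bullet> x)"
        using le neg by (auto simp: almost_negative_def)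
      then show ?thesis
        using neg eigenvector_on_path_vanishes[OF x supp] x0 by (auto simp: almost_negative_def)
    qed simp
  qed
  ultimately show ?thesis by simp
qed

end

section \<open>From graphs to Laplacian matrices on index sets\<close>

lemma (in wf_digraph) awalk_vertex_sequence:
  assumes "awalk u a v"
  obtains q where "q 0 = u" "q (length a) = v"
    "\<And>i. i < length a \<Longrightarrow> (q i, q (i + 1)) \<in> arcs_ends G"
  using assms
proof (induction a arbitrary: u thesis)
  case Nil
  then show ?case by (auto simp: awalk_Nil_iff)
next
  case (Cons e a)
  then have e: "e \<in> arcs G" "u = tail G e" and "awalk (head G e) a v"
    by (auto simp: awalk_Cons_iff)
  then obtain q where q: "q 0 = head G e" "q (length a) = v"
    "\<And>i. i < length a \<Longrightarrow> (q i, q (i + 1)) \<in> arcs_ends G"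
    using Cons.IH by blast
  have "(u, head G e) \<in> arcs_ends G" using e by (auto simp: arcs_ends_def arc_to_ends_def)
  then have "(case_nat u q i, case_nat u q (i + 1)) \<in> arcs_ends G" if "i < length (e # a)" for i
    using q that by (cases i) auto
  then show ?case using q by (intro Cons.prems(1)[of "case_nat u q"]) auto
qed

text \<open>
  A walk that climbs \<open>d\<close> levels in \<open>d\<close> steps cannot lose any.
\<close>

lemma unit_steps_exact:
  fixes f :: "nat \<Rightarrow> int"
  assumes "f 0 = 0" "f d = int d" and step: "\<And>i. i < d \<Longrightarrow> f (i + 1) \<le> f i + 1" and "i \<le> d"
  shows "f i = int i"
proof (rule antisym)
  show "f i \<le> int i" using \<open>i \<le> d\<close>
  proof (induction i)
    case (Suc i)
    then show ?case using step[of i] by simp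
  qed (simp add: assms)
  have "f d \<le> f i + int (d - i)" using \<open>i \<le> d\<close>
  proof (induction rule: inc_induct)
    case (step j)
    then show ?case using assms(3)[of j] by simp
  qed simp
  then show "int i \<le> f i" using assms by simp
qed

text \<open>
  The level function is the distance from one end of a pair of vertices that attains the diameter.
\<close>

lemma (in graph) shortest_path_with_levels:
  assumes "Digraph_Component.connected G" and diam: "graph_diameter G = ereal (real d)"
  obtains q :: "nat \<Rightarrow> 'a" and h :: "'a \<Rightarrow> int"
  where "\<And>i. i \<le> d \<Longrightarrow> q i \<in> verts G"
    "\<And>i. i < d \<Longrightarrow> (q i, q (i + 1)) \<in> arcs_ends G"
    "\<And>i. i \<le> d \<Longrightarrow> h (q i) = int i"
    "\<And>x y. (x, y) \<in> arcs_ends G \<Longrightarrow> h y \<le> h x + 1"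
proof -
  have strong: "strongly_connected G"
    using symmetric_connected_imp_strongly_connected[OF sym_arcs assms(1)] .
  then have ne: "verts G \<noteq> {}" and reach: "\<And>x y. x \<in> verts G \<Longrightarrow> y \<in> verts G \<Longrightarrow> x \<rightarrow>\<^sup>* y"
    by (auto simp: strongly_connected_def)
  let ?c = "\<lambda>_ :: 'b. 1 :: real"
  let ?D = "(\<lambda>(x, y). graph_dist G x y) ` (verts G \<times> verts G)"
  have "Max ?D \<in> ?D" using ne by (intro Max_in) auto
  then have "ereal (real d) \<in> ?D" using diam by (simp only: graph_diameter_def)
  then obtain u v where uv: "u \<in> verts G" "v \<in> verts G" "graph_dist G u v = ereal (real d)"
    by (elim imageE SigmaE) (metis (no_types, lifting) case_prod_conv)
  then have uv_dist: "\<mu> ?c u v = ereal (real d)" by (simp only: graph_dist_def)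
  have shortest: "\<exists>a. awalk x a y \<and> \<mu> ?c x y = ereal (real (length a))"
    if xy: "x \<in> verts G" "y \<in> verts G" for x y
  proof -
    have "\<exists>a. apath x a y \<and> \<mu> ?c x y = ereal (awalk_cost ?c a)"
      by (rule min_cost_awalk[OF reach[OF xy]]) simp
    then obtain a where a: "apath x a y" "\<mu> ?c x y = ereal (awalk_cost ?c a)" by blast
    have "awalk_cost ?c a = real (length a)"
      by (simp add: awalk_cost_def sum_list_triv)
    with a(2) have "\<mu> ?c x y = ereal (real (length a))" by (simp only:)
    moreover from a(1) have "awalk x a y" by (simp only: apath_def)
    ultimately show ?thesis by blast
  qed
  define h where "h x = (SOME k. 0 \<le> k \<and> \<mu> ?c u x = ereal (real_of_int k))" for x
  have h: "0 \<le> h x" "\<mu> ?c u x = ereal (real_of_int (h x))" if x: "x \<in> verts G" for x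
  proof -
    obtain a where "awalk u a x" "\<mu> ?c u x = ereal (real (length a))"
      using shortest[OF uv(1) x] by blast
    then have "\<exists>k. 0 \<le> k \<and> \<mu> ?c u x = ereal (real_of_int k)"
      by (intro exI[of _ "int (length a)"]) simp
    from someI_ex[OF this] show "0 \<le> h x" "\<mu> ?c u x = ereal (real_of_int (h x))"
      by (auto simp: h_def)
  qed
  have lip: "h y \<le> h x + 1" if edge: "(x, y) \<in> arcs_ends G" for x y
  proof -
    obtain e where e: "e \<in> arcs G" "arc_to_ends G e = (x, y)"
      using edge by (auto simp: arcs_ends_def)
    then have xy: "x \<in> verts G" "y \<in> verts G" by (auto simp: arc_to_ends_def)
    have "\<mu> ?c u y \<le> \<mu> ?c u x + ereal 1"
      using pos_cost_mu_triangle[of ?c e x y u] e by simp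
    then show ?thesis by (simp add: h(2)[OF xy(1)] h(2)[OF xy(2)])
  qed
  obtain a where a: "awalk u a v" "\<mu> ?c u v = ereal (real (length a))"
    using shortest[OF uv(1,2)] by blast
  then have len: "length a = d" using uv_dist by simp
  obtain q where q: "q 0 = u" "q d = v" "\<And>i. i < d \<Longrightarrow> (q i, q (i + 1)) \<in> arcs_ends G"
    using awalk_vertex_sequence[OF a(1)] len by metis
  have "h u = 0"
  proof -
    have "awalk u [] u" using uv by (simp add: awalk_Nil_iff)
    from min_cost_le_walk_cost[OF this, of ?c] have "\<mu> ?c u u \<le> ereal 0"
      by (simp add: awalk_cost_def)
    then show ?thesis using h[OF uv(1)] by simp
  qed
  moreover have "h v = int d" using h(2)[OF uv(2)] uv_dist by simp
  ultimately have "h (q i) = int i" if "i \<le> d" for i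
    using unit_steps_exact[of "\<lambda>i. h (q i)" d i] q lip that by simp
  moreover have "q i \<in> verts G" if "i \<le> d" for i
  proof (cases "i < d")
    case True
    then show ?thesis using q(3)[of i] by (auto simp: arcs_ends_def arc_to_ends_def)
  next
    case False
    then show ?thesis using that q(2) uv by simp
  qed
  ultimately show ?thesis using that q(3) lip by blast
qed

lemma (in digraph) out_degree_eq_card_neighbours:
  "out_degree G x = card {y. (x, y) \<in> arcs_ends G}"
proof -
  have "inj_on (head G) (out_arcs G x)"
    using no_multi_arcs by (auto simp: inj_on_def out_arcs_def arc_to_ends_def)
  moreover have "head G ` out_arcs G x = {y. (x, y) \<in> arcs_ends G}"
    by (auto simp: out_arcs_def arcs_ends_def arc_to_ends_def)
  ultimately show ?thesis by (metis card_image out_degree_def)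
qed

lemma (in digraph) laplacian_mat_eq_graph_laplacian:
  assumes vs: "distinct vs" "set vs = verts G"
  shows "laplacian_mat G vs = graph_laplacian (length vs)
    (\<lambda>i j. i < length vs \<and> j < length vs \<and> (vs ! i, vs ! j) \<in> arcs_ends G)"
    (is "_ = graph_laplacian ?n ?E")
proof (rule eq_matI)
  fix i j assume "i < dim_row (graph_laplacian ?n ?E)" "j < dim_col (graph_laplacian ?n ?E)"
  then have ij: "i < ?n" "j < ?n" by (auto simp: graph_laplacian_def)
  have "out_degree G (vs ! i) = card ((!) vs ` {k. ?E i k})"
  proof -
    have "{y. (vs ! i, y) \<in> arcs_ends G} = (!) vs ` {k. ?E i k}"
    proof (intro equalityI subsetI)
      fix y assume y: "y \<in> {y. (vs ! i, y) \<in> arcs_ends G}"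
      then have "y \<in> set vs" unfolding vs(2) by (auto simp: arcs_ends_def arc_to_ends_def)
      then show "y \<in> (!) vs ` {k. ?E i k}" using y ij by (auto simp: in_set_conv_nth)
    qed auto
    then show ?thesis unfolding out_degree_eq_card_neighbours by simp
  qed
  also have "\<dots> = card {k. ?E i k}"
    using vs(1) by (intro card_image inj_on_subset[OF inj_on_nth[OF vs(1), of "{..<?n}"]]) auto
  finally show "laplacian_mat G vs $$ (i, j) = graph_laplacian ?n ?E $$ (i, j)"
    using ij by (auto simp: laplacian_mat_def degree_mat_def adjacency_mat_def graph_laplacian_def)
qed (auto simp: laplacian_mat_def degree_mat_def adjacency_mat_def graph_laplacian_def)

theorem theorem1p4:
  fixes G :: "('a, 'b) pre_digraph" and vs :: "'a list" and n d :: nat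
  assumes "graph G"
    and "Digraph_Component.connected G"
    and "distinct vs" and "set vs = verts G"
    and "card (verts G) = n"
    and "graph_diameter G = ereal (real d)"
    and "2 \<le> d" and "d + 4 \<le> n"
  shows "(d \<in> {2, 3, 4} \<longrightarrow> laplacian_count G vs {real n - real d .. real n} \<le> n - d + 1) \<and>
         (d \<ge> 5 \<longrightarrow> laplacian_count G vs {real n - real d .. real n} \<le> n - d + 2)"
proof -
  interpret graph G by fact
  have len: "length vs = n" using assms(3,4,5) distinct_card by metis
  let ?E = "\<lambda>i j. i < length vs \<and> j < length vs \<and> (vs ! i, vs ! j) \<in> arcs_ends G"
  obtain q h where q: "\<And>i. i \<le> d \<Longrightarrow> q i \<in> verts G"
    "\<And>i. i < d \<Longrightarrow> (q i, q (i + 1)) \<in> arcs_ends G"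
    and h: "\<And>i. i \<le> d \<Longrightarrow> h (q i) = int i"
    "\<And>x y. (x, y) \<in> arcs_ends G \<Longrightarrow> h y \<le> h x + 1"
    using shortest_path_with_levels[OF assms(2,6)] by blast
  have "\<exists>k<n. vs ! k = q i" if "i \<le> d" for i
    using q(1)[OF that] assms(4) len by (metis in_set_conv_nth)
  then obtain p where p: "\<And>i. i \<le> d \<Longrightarrow> p i < n \<and> vs ! p i = q i" by metis
  have sym: "(y, x) \<in> arcs_ends G" if "(x, y) \<in> arcs_ends G" for x y
    using that sym_arcs by (auto simp: symmetric_def sym_def)
  interpret geodesic n d ?E p "\<lambda>k. h (vs ! k)"
  proof
    show "\<not> ?E i i" for i
      by (auto simp: arcs_ends_def arc_to_ends_def) (metis no_loops)
    show "?E (p i) (p (i + 1))" if "i < d" for i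
      using q(2)[OF that] p[of i] p[of "i + 1"] that len by simp
  qed (use p h sym len in auto)
  have "laplacian_count G vs {real n - real d .. real n}
      \<le> size {# t \<in># proots (char_poly L). real n - real d \<le> t #}"
    unfolding laplacian_count_def laplacian_eigenvalues_def
      laplacian_mat_eq_graph_laplacian[OF assms(3,4)] len
    by (intro size_mset_mono mset_subset_eqI) auto
  also have "\<dots> \<le> n - d - 1 + (if d \<le> 4 then 2 else 3)"
    using assms(7,8) by (rule large_eigenvalue_count)
  finally show ?thesis using assms(8) by auto
qed

end
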